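(* Let $f = f_{0}+\sum_{j=1}^n f_{\alpha(j)} x^{\alpha(j)} +\sum_{\alpha \in \Delta(f)} f_\alpha x^\alpha\in\mathbb{R}[x_1,\dots,x_n]$ be an ST-polynomial in standard form. Define: - $f_{\mathrm{gp1}}$ as the supremum of all $r\in \mathbb{R}$ such that for every $\alpha \in \Delta(f)$ there exist nonnegative reals $a_{\alpha,1},\ldots, a_{\alpha,n}$ such that the following conditions are satisfied: (0) if $\lambda_j^{(\alpha)}>0$, then $a_{\alpha,j} > 0$, for all $(\alpha,j)\in\Delta(f)\times\{1,\dots,n\}$; (1) $|f_\alpha| \leq \prod_{j\in \mathrm{nz}(\alpha),\, j\geq 1} \left(\frac{a_{\alpha,j}}{\lambda_j^{(\alpha)}}\right)^{\lambda_j^{(\alpha)}}$ for every $\alpha \in \Delta(f)$ with $\lambda_0^{(\alpha)}=0$; (2) $f_{\alpha(j)} \geq \sum_{\alpha\in \Delta(f)} a_{\alpha,j}$ for all $j = 1,\ldots,n$; (3) $f_0-r \geq \sum_{\alpha \in \Delta(f),\, 0 \in \mathrm{nz}(\alpha)} \lambda_0^{(\alpha)} |f_\alpha|^{1/\lambda_0^{(\alpha)}} \prod_{j\in \mathrm{nz}(\alpha),\, j\geq 1} \left(\frac{\lambda_j^{(\alpha)}}{a_{\alpha,j}}\right)^{\lambda_j^{(\alpha)}/\lambda_0^{(\alpha)}}$; - $f_{\mathrm{gp2}}$ as the supremum of all $r\in \mathbb{R}$ such that there exist nonnegative circuit polynomials $g_1, g_2, \ldots, g_s$ whose Newton polytopes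 are faces of $\mathrm{conv}(\{0\} \cup V(f))$ such that $f-r =\sum_{k=1}^s g_k$. Then these quantities are equal, i.e., $f_{\mathrm{gp1}}=f_{\mathrm{gp2}}$.
   Context: Notation: $\mathbb{N}$ contains $0$; $x^\alpha = x_1^{\alpha_1}\cdots x_n^{\alpha_n}$; $\mathrm{New}(f)$ is the Newton polytope (convex hull of the exponents with nonzero coefficient) and $V(f)$ is the vertex set of $\mathrm{New}(f)$. A polynomial is nonnegative if it is $\geq 0$ on all of $\mathbb{R}^n$. Suprema are taken in $\mathbb{R}\cup\{\pm\infty\}$ with $\sup\emptyset=-\infty$. An ST-polynomial in standard form is a polynomial $f = f_{\alpha(0)}+\sum_{j=1}^n f_{\alpha(j)} x^{\alpha(j)} +\sum_{\alpha \in \Delta} f_\alpha x^\alpha$ such that: (ST1) $\alpha(0)=0$ and $\alpha(1),\ldots,\alpha(n)$ form a set $V$ of affinely independent points in $(2\mathbb{N})^n$. (ST2) $\Delta$ is the set of exponents $\alpha$ in $f$ not defining monomial squares, i.e. $\alpha\in\Delta$ iff $f_\alpha<0$, or $\alpha\notin(2\mathbb{N})^n$ and $f_\alpha>0$. (ST3) $\Delta\subseteq \mathrm{conv}(V)$; equivalently every $\alpha\in\Delta$ is uniquely written $\alpha=\sum_{j=0}^n\lambda_j^{(\alpha)}\alpha(j)$ with $\lambda_j^{(\alpha)}\ge 0$, $\sum_{j=0}^n\lambda_j^{(\alpha)}=1$. (ST4) $f_0 = f_{\alpha(0)},f_{\alpha(1)},\ldots,f_{\alpha(n)}$ are nonnegative,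 and if $f_{\alpha(j)}=0$ then $\lambda_j^{(\alpha)}=0$ for all $\alpha\in\Delta$. One writes $\Delta(f)=\Delta$ and $\mathrm{nz}(\alpha)=\{j\in\{0,\ldots,n\}:\lambda_j^{(\alpha)}\neq 0\}$. A circuit polynomial is an ST-polynomial whose set $\Delta$ is empty or a singleton. *)

theory Defs
  imports "HOL-Analysis.Analysis" "HOL-Library.Poly_Mapping"
begin

text \<open>
  The variables are indexed by a finite type \<open>'n\<close>, so that \<open>n = CARD('n)\<close>.  A real polynomial is
  its finitely supported coefficient function on the exponents \<open>nat ^ 'n\<close>.
\<close>

type_synonym 'n rpoly = "(nat ^ 'n) \<Rightarrow>\<^sub>0 real"

abbreviation coeff_at :: "'n::finite rpoly \<Rightarrow> nat ^ 'n \<Rightarrow> real" where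
  "coeff_at \<equiv> Poly_Mapping.lookup"

definition const_poly :: "real \<Rightarrow> 'n::finite rpoly" where
  "const_poly r = Poly_Mapping.single 0 r"

definition eval_poly :: "'n::finite rpoly \<Rightarrow> real ^ 'n \<Rightarrow> real" where
  "eval_poly f x = (\<Sum>\<alpha>\<in>Poly_Mapping.keys f. coeff_at f \<alpha> * (\<Prod>i\<in>UNIV. (x $ i) ^ (\<alpha> $ i)))"

definition nonneg_poly :: "'n::finite rpoly \<Rightarrow> bool" where
  "nonneg_poly f \<longleftrightarrow> (\<forall>x. eval_poly f x \<ge> 0)"

definition pt :: "nat ^ 'n \<Rightarrow> real ^ 'n::finite" where
  "pt \<alpha> = (\<chi> i. real (\<alpha> $ i))"

definition even_exp :: "nat ^ 'n::finite \<Rightarrow> bool" where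
  "even_exp \<alpha> \<longleftrightarrow> (\<forall>i. even (\<alpha> $ i))"

definition newton :: "'n::finite rpoly \<Rightarrow> (real ^ 'n) set" where
  "newton f = convex hull (pt ` Poly_Mapping.keys f)"

definition newton_vertices :: "'n::finite rpoly \<Rightarrow> (real ^ 'n) set" where
  "newton_vertices f = {v. v extreme_point_of newton f}"

definition nonsquare_exps :: "'n::finite rpoly \<Rightarrow> (nat ^ 'n) set" ("\<Delta>") where
  "\<Delta> f = {\<alpha>. coeff_at f \<alpha> < 0 \<or> (\<not> even_exp \<alpha> \<and> coeff_at f \<alpha> > 0)}"

text \<open>
  The nodes \<open>\<alpha>(0), \<dots>, \<alpha>(n)\<close> are the values of \<open>A :: nat \<Rightarrow> nat ^ 'n\<close> on \<open>{..CARD('n)}\<close>; other values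
  of \<open>A\<close> are irrelevant.  \<open>bary A \<alpha> j\<close> is \<open>\<lambda>\<^sub>j\<close> for the exponent \<open>\<alpha>\<close>; it is meaningful for
  affinely independent nodes and \<open>\<alpha>\<close> in their convex hull.
\<close>

definition is_bary :: "(nat \<Rightarrow> nat ^ 'n::finite) \<Rightarrow> nat ^ 'n \<Rightarrow> (nat \<Rightarrow> real) \<Rightarrow> bool" where
  "is_bary A \<alpha> l \<longleftrightarrow>
     (\<forall>j\<le>CARD('n). l j \<ge> 0) \<and> (\<forall>j>CARD('n). l j = 0) \<and>
     (\<Sum>j\<le>CARD('n). l j) = 1 \<and> (\<Sum>j\<le>CARD('n). l j *\<^sub>R pt (A j)) = pt \<alpha>"

definition bary :: "(nat \<Rightarrow> nat ^ 'n::finite) \<Rightarrow> nat ^ 'n \<Rightarrow> nat \<Rightarrow> real" where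
  "bary A \<alpha> = (THE l. is_bary A \<alpha> l)"

lemma inj_pt: "inj pt"
  by (auto simp: inj_def pt_def vec_eq_iff)

text \<open>Well-definedness of \<open>bary\<close> under the hypotheses on the nodes and \<open>\<Delta> f\<close> that follow.\<close>

lemma is_bary_bary:
  fixes A :: "nat \<Rightarrow> nat ^ 'n::finite"
  assumes inj: "inj_on A {..CARD('n)}"
    and indep: "\<not> affine_dependent (pt ` A ` {..CARD('n)})"
    and hull: "pt \<alpha> \<in> convex hull (pt ` A ` {..CARD('n)})"
  shows "\<exists>!l. is_bary A \<alpha> l" and "is_bary A \<alpha> (bary A \<alpha>)"
proof -
  let ?N = "{..CARD('n)}"
  let ?P = "\<lambda>j. pt (A j)"
  have injP: "inj_on ?P ?N"
    using inj inj_pt by (auto simp: inj_on_def inj_def)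
  have img: "pt ` A ` ?N = ?P ` ?N" by auto
  obtain u where u: "\<forall>x\<in>?P ` ?N. 0 \<le> u x" "sum u (?P ` ?N) = 1"
      "(\<Sum>x\<in>?P ` ?N. u x *\<^sub>R x) = pt \<alpha>"
    using hull unfolding img by (subst (asm) convex_hull_finite) auto
  let ?u = "\<lambda>j. if j \<le> CARD('n) then u (?P j) else 0"
  have "sum ?u ?N = (\<Sum>j\<in>?N. u (?P j))" by (rule sum.cong) auto
  moreover have "(\<Sum>j\<in>?N. ?u j *\<^sub>R ?P j) = (\<Sum>j\<in>?N. u (?P j) *\<^sub>R ?P j)"
    by (rule sum.cong) auto
  ultimately have "is_bary A \<alpha> ?u"
    using u unfolding is_bary_def by (simp add: sum.reindex[OF injP])
  moreover have "l = l'" if l: "is_bary A \<alpha> l" and l': "is_bary A \<alpha> l'" for l l'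
  proof (rule ext, rule ccontr)
    fix k assume ne: "l k \<noteq> l' k"
    hence k: "k \<in> ?N" using l l' by (force simp: is_bary_def not_le[symmetric])
    define U where "U = (\<lambda>v. l (inv_into ?N ?P v) - l' (inv_into ?N ?P v))"
    have U: "U (?P j) = l j - l' j" if "j \<in> ?N" for j
      using that injP by (simp add: U_def inv_into_f_f[OF injP])
    have "sum U (?P ` ?N) = (\<Sum>j\<in>?N. l j - l' j)"
      using U by (simp add: sum.reindex[OF injP])
    also have "\<dots> = 0" using l l' by (simp add: is_bary_def sum_subtractf)
    finally have s0: "sum U (?P ` ?N) = 0" .
    have "(\<Sum>v\<in>?P ` ?N. U v *\<^sub>R v) = (\<Sum>j\<in>?N. (l j - l' j) *\<^sub>R ?P j)"
      using U by (simp add: sum.reindex[OF injP])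
    also have "\<dots> = 0"
      using l l' by (simp add: is_bary_def sum_subtractf scaleR_left_diff_distrib)
    finally have s1: "(\<Sum>v\<in>?P ` ?N. U v *\<^sub>R v) = 0" .
    have "U (?P k) \<noteq> 0" using U[OF k] ne by simp
    with s0 s1 k have "affine_dependent (?P ` ?N)"
      by (subst affine_dependent_explicit_finite) blast+
    with indep img show False by simp
  qed
  ultimately show "\<exists>!l. is_bary A \<alpha> l" by blast
  then show "is_bary A \<alpha> (bary A \<alpha>)"
    unfolding bary_def by (rule theI')
qed

definition nz :: "(nat \<Rightarrow> nat ^ 'n::finite) \<Rightarrow> nat ^ 'n \<Rightarrow> nat set" where
  "nz A \<alpha> = {j. j \<le> CARD('n) \<and> bary A \<alpha> j \<noteq> 0}"

text \<open>
  In the definition below, injectivity of \<open>A\<close> is needed because affine (in)dependence in the library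
  is a property of the set of nodes, which would otherwise allow repeated nodes.
\<close>

definition st_standard_form :: "'n::finite rpoly \<Rightarrow> (nat \<Rightarrow> nat ^ 'n) \<Rightarrow> bool" where
  "st_standard_form f A \<longleftrightarrow>
     Poly_Mapping.keys f \<subseteq> A ` {..CARD('n)} \<union> \<Delta> f \<and>
     A 0 = 0 \<and> inj_on A {..CARD('n)} \<and>
     \<not> affine_dependent (pt ` A ` {..CARD('n)}) \<and>
     (\<forall>j\<le>CARD('n). even_exp (A j)) \<and>
     pt ` \<Delta> f \<subseteq> convex hull (pt ` A ` {..CARD('n)}) \<and>
     (\<forall>j\<le>CARD('n). coeff_at f (A j) \<ge> 0) \<and>
     (\<forall>j\<le>CARD('n). coeff_at f (A j) = 0 \<longrightarrow> (\<forall>\<alpha>\<in>\<Delta> f. bary A \<alpha> j = 0))"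

definition circuit_poly :: "'n::finite rpoly \<Rightarrow> bool" where
  "circuit_poly g \<longleftrightarrow> (\<exists>A. st_standard_form g A) \<and> (\<Delta> g = {} \<or> (\<exists>\<beta>. \<Delta> g = {\<beta>}))"

definition gp1_feasible ::
    "'n::finite rpoly \<Rightarrow> (nat \<Rightarrow> nat ^ 'n) \<Rightarrow> real \<Rightarrow> (nat ^ 'n \<Rightarrow> nat \<Rightarrow> real) \<Rightarrow> bool" where
  "gp1_feasible f A r a \<longleftrightarrow>
     (\<forall>\<alpha>\<in>\<Delta> f. \<forall>j\<in>{1..CARD('n)}. a \<alpha> j \<ge> 0) \<and>
     (\<forall>\<alpha>\<in>\<Delta> f. \<forall>j\<in>{1..CARD('n)}. bary A \<alpha> j > 0 \<longrightarrow> a \<alpha> j > 0) \<and>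
     (\<forall>\<alpha>\<in>\<Delta> f. bary A \<alpha> 0 = 0 \<longrightarrow>
        \<bar>coeff_at f \<alpha>\<bar> \<le> (\<Prod>j\<in>{j\<in>nz A \<alpha>. j \<ge> 1}. (a \<alpha> j / bary A \<alpha> j) powr bary A \<alpha> j)) \<and>
     (\<forall>j\<in>{1..CARD('n)}. coeff_at f (A j) \<ge> (\<Sum>\<alpha>\<in>\<Delta> f. a \<alpha> j)) \<and>
     coeff_at f 0 - r \<ge>
       (\<Sum>\<alpha>\<in>{\<alpha>\<in>\<Delta> f. 0 \<in> nz A \<alpha>}.
          bary A \<alpha> 0 * \<bar>coeff_at f \<alpha>\<bar> powr (1 / bary A \<alpha> 0) *
          (\<Prod>j\<in>{j\<in>nz A \<alpha>. j \<ge> 1}. (bary A \<alpha> j / a \<alpha> j) powr (bary A \<alpha> j / bary A \<alpha> 0)))"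

definition gp1 :: "'n::finite rpoly \<Rightarrow> (nat \<Rightarrow> nat ^ 'n) \<Rightarrow> ereal" where
  "gp1 f A = (SUP r\<in>{r. \<exists>a. gp1_feasible f A r a}. ereal r)"

definition gp2_feasible :: "'n::finite rpoly \<Rightarrow> real \<Rightarrow> bool" where
  "gp2_feasible f r \<longleftrightarrow>
     (\<exists>(s::nat) g.
        (\<forall>k\<in>{1..s}. circuit_poly (g k) \<and> nonneg_poly (g k) \<and>
           newton (g k) face_of (convex hull ({0} \<union> newton_vertices f))) \<and>
        f - const_poly r = (\<Sum>k=1..s. g k))"

definition gp2 :: "'n::finite rpoly \<Rightarrow> ereal" where
  "gp2 f = (SUP r\<in>{r. gp2_feasible f r}. ereal r)"

end

theory Submission
  imports Defs
begin

text \<open>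
  The two suprema agree because they range over the same set of real numbers \<open>r\<close>.  The bridge is
  the circuit number: a polynomial \<open>\<Sum>\<^sub>j b\<^sub>j x\<^bsup>\<alpha>(j)\<^esup> + c x\<^sup>\<alpha>\<close> with even nodes \<open>\<alpha>(j)\<close>, coefficients
  \<open>b\<^sub>j \<ge> 0\<close> that are positive on \<open>nz \<alpha>\<close>, and a term \<open>c x\<^sup>\<alpha>\<close> that is not a monomial square, where \<open>\<alpha> = \<Sum>\<^sub>j \<lambda>\<^sub>j \<alpha>(j)\<close> is a convex
  combination of the nodes, is nonnegative iff \<open>\<bar>c\<bar> \<le> \<Prod>\<^sub>j (b\<^sub>j / \<lambda>\<^sub>j) powr \<lambda>\<^sub>j\<close>, the product running over \<open>nz \<alpha>\<close>.  If \<open>\<lambda>\<^sub>0 = 0\<close> this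
  inequality is condition (1); if \<open>\<lambda>\<^sub>0 > 0\<close>, solving it for the constant coefficient \<open>b\<^sub>0\<close> gives
  the summand of \<open>\<alpha>\<close> in condition (3) as the least admissible \<open>b\<^sub>0\<close>
  (\<open>circuit_number_le_iff_constant_ge\<close>).

  The "if" half of the criterion is the weighted AM-GM inequality, because \<open>\<bar>x\<^sup>\<alpha>\<bar>\<close> is the weighted
  geometric mean of the \<open>x\<^bsup>\<alpha>(j)\<^esup>\<close>.  For the "only if" half, the nonzero nodes are linearly
  independent, so the ratios of the values \<open>x\<^bsup>\<alpha>(j)\<^esup>\<close> to \<open>x\<^bsup>\<alpha>(0)\<^esup> = 1\<close> can be prescribed freely while the
  sign of \<open>c x\<^sup>\<alpha>\<close> is made negative.  Hence nonnegativity amounts to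
  \<open>\<bar>c\<bar> \<Prod>\<^sub>j v\<^sub>j powr \<lambda>\<^sub>j \<le> \<Sum>\<^sub>j b\<^sub>j v\<^sub>j\<close> for all positive \<open>v\<close> (\<open>nonneg_st_imp_bound\<close>), and the choice
  \<open>v\<^sub>j = t \<lambda>\<^sub>j / b\<^sub>j\<close> on \<open>nz \<alpha>\<close>, \<open>t \<rightarrow> \<infinity>\<close>, which is the equality case of AM-GM, extracts the
  circuit number (\<open>bound_imp_circuit_number\<close>).

  A feasible \<open>a\<close> for the first programme therefore yields one nonnegative circuit polynomial for
  each \<open>\<alpha> \<in> \<Delta> f\<close>, with Newton polytope the face spanned by \<open>nz \<alpha>\<close>; what remains of \<open>f - r\<close> is a
  sum of even monomials with nonnegative coefficients, itself a circuit polynomial with empty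
  \<open>\<Delta>\<close>.

  Conversely, let \<open>f - r = \<Sum>\<^sub>k g\<^sub>k\<close>.  Faces of a simplex are spanned by its vertices, so every \<open>g\<^sub>k\<close>
  is in standard form with respect to the nodes of \<open>f\<close> (\<open>st_standard_form_transfer\<close>).  Let
  \<open>a\<^sub>\<alpha>\<^sub>,\<^sub>j\<close> be the sum of the coefficients at \<open>\<alpha>(j)\<close> of all \<open>g\<^sub>k\<close> with \<open>\<Delta> g\<^sub>k = {\<alpha>}\<close>.  The displayed
  inequality in \<open>v\<close> is additive in \<open>g\<^sub>k\<close>, so it survives the summation and produces the circuit number
  condition for \<open>f\<^sub>\<alpha>\<close>, even where coefficients of different \<open>g\<^sub>k\<close> at \<open>\<alpha>\<close> partly cancel.
\<close>

definition monom_at :: "real ^ 'n \<Rightarrow> nat ^ 'n::finite \<Rightarrow> real" where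
  "monom_at x \<beta> = (\<Prod>i\<in>UNIV. (x $ i) ^ (\<beta> $ i))"

text \<open>
  The conditions of the standard form that concern the nodes alone, so that the nodes of one
  polynomial can be reused for another.
\<close>

definition even_simplex :: "(nat \<Rightarrow> nat ^ 'n::finite) \<Rightarrow> bool" where
  "even_simplex A \<longleftrightarrow> A 0 = 0 \<and> inj_on A {..CARD('n)} \<and>
     \<not> affine_dependent (pt ` A ` {..CARD('n)}) \<and> (\<forall>j\<le>CARD('n). even_exp (A j))"

definition pos_nodes :: "'n::finite rpoly \<Rightarrow> (nat \<Rightarrow> nat ^ 'n) \<Rightarrow> nat set" where
  "pos_nodes g A = {j. j \<le> CARD('n) \<and> coeff_at g (A j) > 0}"

section \<open>Weighted arithmetic-geometric mean inequality\<close>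

lemma weighted_am_gm:
  fixes l x :: "'i \<Rightarrow> real"
  assumes I: "finite I" and l: "\<And>j. j \<in> I \<Longrightarrow> l j > 0" and s: "sum l I = 1"
    and x: "\<And>j. j \<in> I \<Longrightarrow> x j > 0"
  shows "(\<Prod>j\<in>I. x j powr l j) \<le> (\<Sum>j\<in>I. l j * x j)"
proof -
  have ne: "I \<noteq> {}" using s by auto
  have "exp (\<Sum>j\<in>I. l j *\<^sub>R ln (x j)) \<le> (\<Sum>j\<in>I. l j * exp (ln (x j)))"
    by (rule convex_on_sum[OF I ne exp_convex s]) (use l in \<open>auto simp: less_imp_le\<close>)
  moreover have "exp (\<Sum>j\<in>I. l j *\<^sub>R ln (x j)) = (\<Prod>j\<in>I. x j powr l j)"
    unfolding exp_sum[OF I] using x by (intro prod.cong) (auto simp: powr_def dest: x)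
  ultimately show ?thesis using x by simp
qed

text \<open>
  AM-GM applied to the numbers \<open>b\<^sub>j v\<^sub>j / \<lambda>\<^sub>j\<close>: the weights cancel in the arithmetic mean, and the
  geometric mean splits off the circuit number.
\<close>

lemma circuit_number_imp_bound:
  fixes l b v :: "'i \<Rightarrow> real"
  assumes I: "finite I" and l: "\<And>j. j \<in> I \<Longrightarrow> l j > 0" and s: "sum l I = 1"
    and b: "\<And>j. j \<in> I \<Longrightarrow> b j > 0" and v: "\<And>j. j \<in> I \<Longrightarrow> v j > 0"
    and c: "c \<le> (\<Prod>j\<in>I. (b j / l j) powr l j)"
  shows "c * (\<Prod>j\<in>I. v j powr l j) \<le> (\<Sum>j\<in>I. b j * v j)"
proof -
  have "c * (\<Prod>j\<in>I. v j powr l j) \<le> (\<Prod>j\<in>I. (b j / l j) powr l j) * (\<Prod>j\<in>I. v j powr l j)"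
    using c by (intro mult_right_mono prod_nonneg) auto
  also have "\<dots> = (\<Prod>j\<in>I. (b j / l j * v j) powr l j)"
    by (simp only: prod.distrib[symmetric] powr_mult[symmetric])
  also have "\<dots> \<le> (\<Sum>j\<in>I. l j * (b j / l j * v j))"
    by (rule weighted_am_gm[OF I l s]) (use b l v in auto)
  also have "\<dots> = (\<Sum>j\<in>I. b j * v j)"
    by (intro sum.cong) (auto dest: l)
  finally show ?thesis .
qed

text \<open>
  Equality in AM-GM is attained along the ray \<open>v\<^sub>j = t \<lambda>\<^sub>j / b\<^sub>j\<close>.  Both sides of the bound are
  homogeneous of degree 1 up to the additive constant \<open>C\<close>, and \<open>C\<close> is negligible for large \<open>t\<close>.
  The constant makes room for nodes outside \<open>nz \<alpha>\<close>, whose contribution stays bounded.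
\<close>

lemma bound_imp_circuit_number:
  fixes l b :: "'i \<Rightarrow> real"
  assumes I: "finite I" and l: "\<And>j. j \<in> I \<Longrightarrow> l j > 0" and s: "sum l I = 1"
    and b: "\<And>j. j \<in> I \<Longrightarrow> b j > 0"
    and bound: "\<And>v. (\<And>j. j \<in> I \<Longrightarrow> v j > 0) \<Longrightarrow>
                  c * (\<Prod>j\<in>I. v j powr l j) \<le> (\<Sum>j\<in>I. b j * v j) + C"
  shows "c \<le> (\<Prod>j\<in>I. (b j / l j) powr l j)"
proof (rule ccontr)
  define Q where "Q = (\<Prod>j\<in>I. (b j / l j) powr l j)"
  assume "\<not> ?thesis"
  hence cQ: "c > Q" by (simp add: Q_def)
  have Qpos: "Q > 0" unfolding Q_def using b l by (intro prod_pos) fastforce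
  have lin: "c / Q * t \<le> t + C" if t: "t > 0" for t
  proof -
    let ?v = "\<lambda>j. t * (l j / b j)"
    have "(\<Prod>j\<in>I. ?v j powr l j) = (\<Prod>j\<in>I. t powr l j) * (\<Prod>j\<in>I. (l j / b j) powr l j)"
      by (simp only: powr_mult prod.distrib)
    also have "(\<Prod>j\<in>I. t powr l j) = t" using t s by (simp add: powr_sum[symmetric])
    also have "(\<Prod>j\<in>I. (l j / b j) powr l j) = 1 / Q"
      unfolding Q_def by (simp add: powr_divide prod_dividef)
    finally have 1: "(\<Prod>j\<in>I. ?v j powr l j) = t * (1 / Q)" .
    have "(\<Sum>j\<in>I. b j * ?v j) = (\<Sum>j\<in>I. t * l j)"
      by (intro sum.cong) (auto dest: b)
    also have "\<dots> = t" using s by (simp add: sum_distrib_left[symmetric])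
    finally have 2: "(\<Sum>j\<in>I. b j * ?v j) = t" .
    have "c * (\<Prod>j\<in>I. ?v j powr l j) \<le> (\<Sum>j\<in>I. b j * ?v j) + C"
      by (rule bound) (use b l t in auto)
    thus ?thesis unfolding 1 2 by (simp add: mult.commute)
  qed
  \<comment> \<open>The inequality \<open>lin\<close> fails once \<open>t (c / Q - 1)\<close> exceeds \<open>C\<close>.\<close>
  define e where "e = c / Q - 1"
  have e: "e > 0" using cQ Qpos by (simp add: e_def)
  define t where "t = (\<bar>C\<bar> + 1) / e"
  have t: "t > 0" using e by (simp add: t_def add_nonneg_pos)
  have "t * e \<le> C" using lin[OF t] by (simp add: e_def algebra_simps)
  moreover have "t * e = \<bar>C\<bar> + 1" using e by (simp add: t_def)
  ultimately show False by linarith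
qed

text \<open>
  This links the circuit number to condition (3): raising to the power \<open>1 / \<lambda>\<^sub>0\<close> isolates the
  factor \<open>b\<^sub>0 / \<lambda>\<^sub>0\<close> that belongs to the constant term.
\<close>

lemma circuit_number_le_iff_constant_ge:
  fixes l b :: "'i \<Rightarrow> real"
  assumes I: "finite I" and l: "\<And>j. j \<in> I \<Longrightarrow> l j > 0" and b: "\<And>j. j \<in> I \<Longrightarrow> b j > 0"
    and l0: "l0 > 0" and b0: "b0 \<ge> 0" and c: "c > 0"
  shows "c \<le> (b0 / l0) powr l0 * (\<Prod>j\<in>I. (b j / l j) powr l j) \<longleftrightarrow>
         l0 * c powr (1 / l0) * (\<Prod>j\<in>I. (l j / b j) powr (l j / l0)) \<le> b0"
proof -
  define Q where "Q = (\<Prod>j\<in>I. (b j / l j) powr l j)"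
  have Qpos: "Q > 0" unfolding Q_def using b l by (intro prod_pos) fastforce
  have "(\<Prod>j\<in>I. (l j / b j) powr (l j / l0)) = (\<Prod>j\<in>I. (1 / (b j / l j) powr l j) powr (1 / l0))"
    by (intro prod.cong) (auto simp: powr_divide powr_powr)
  also have "\<dots> = (1 / Q) powr (1 / l0)"
    unfolding Q_def prod_powr_distrib[symmetric] by (simp add: prod_dividef)
  finally have P: "(\<Prod>j\<in>I. (l j / b j) powr (l j / l0)) = (1 / Q) powr (1 / l0)" .
  have "c \<le> (b0 / l0) powr l0 * Q \<longleftrightarrow> c / Q \<le> (b0 / l0) powr l0"
    using Qpos by (simp add: field_simps)
  also have "\<dots> \<longleftrightarrow> (c / Q) powr (1 / l0) \<le> b0 / l0"
  proof
    assume "c / Q \<le> (b0 / l0) powr l0"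
    hence "(c / Q) powr (1 / l0) \<le> ((b0 / l0) powr l0) powr (1 / l0)"
      using c Qpos l0 by (intro powr_mono2) auto
    thus "(c / Q) powr (1 / l0) \<le> b0 / l0" using l0 b0 by (simp add: powr_powr)
  next
    assume "(c / Q) powr (1 / l0) \<le> b0 / l0"
    hence "((c / Q) powr (1 / l0)) powr l0 \<le> (b0 / l0) powr l0"
      using l0 by (intro powr_mono2) auto
    thus "c / Q \<le> (b0 / l0) powr l0" using l0 c Qpos by (simp add: powr_powr)
  qed
  also have "\<dots> \<longleftrightarrow> l0 * (c powr (1 / l0) * (1 / Q) powr (1 / l0)) \<le> b0"
    using l0 by (simp add: powr_mult[symmetric] field_simps)
  finally show ?thesis unfolding P Q_def by (simp add: mult.assoc)
qed

section \<open>Barycentric coordinates\<close>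

lemma pt_0 [simp]: "pt 0 = 0"
  by (simp add: pt_def vec_eq_iff)

lemma even_simplex_st: "st_standard_form g A \<Longrightarrow> even_simplex A"
  by (simp add: st_standard_form_def even_simplex_def)

lemma even_simplex_injD: "even_simplex (A :: nat \<Rightarrow> nat ^ 'n::finite) \<Longrightarrow> A i = A j \<Longrightarrow> i \<le> CARD('n) \<Longrightarrow> j \<le> CARD('n) \<Longrightarrow> i = j"
  by (auto simp: even_simplex_def inj_on_def)

lemma inj_on_pt_nodes:
  fixes A :: "nat \<Rightarrow> nat ^ 'n::finite"
  assumes "even_simplex A"
  shows "inj_on (\<lambda>j. pt (A j)) {..CARD('n)}"
  using comp_inj_on[of A "{..CARD('n)}" pt] assms inj_pt
  by (auto simp: even_simplex_def comp_def intro: inj_on_subset)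

lemma is_bary_bary_simplex:
  fixes A :: "nat \<Rightarrow> nat ^ 'n::finite"
  assumes "even_simplex A" "pt \<alpha> \<in> convex hull (pt ` A ` {..CARD('n)})"
  shows "is_bary A \<alpha> (bary A \<alpha>)"
  using assms is_bary_bary(2) by (auto simp: even_simplex_def)

text \<open>
  Coordinates with respect to the vertices of the face, extended by zero, are barycentric
  coordinates for the whole simplex, which are unique.
\<close>

lemma bary_eq_0_outside_face:
  fixes A :: "nat \<Rightarrow> nat ^ 'n::finite"
  assumes A: "even_simplex A" and S: "S \<subseteq> {..CARD('n)}" and h: "pt \<alpha> \<in> convex hull (pt ` A ` S)"
    and j: "j \<notin> S"
  shows "bary A \<alpha> j = 0"
proof -
  let ?P = "\<lambda>j. pt (A j)"
  have fin: "finite S" using S finite_subset by blast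
  have injP: "inj_on ?P S"
    using inj_on_pt_nodes[OF A] S by (rule inj_on_subset)
  have img: "pt ` A ` S = ?P ` S" by auto
  obtain u where u: "\<forall>x\<in>?P ` S. 0 \<le> u x" "sum u (?P ` S) = 1"
      "(\<Sum>x\<in>?P ` S. u x *\<^sub>R x) = pt \<alpha>"
    using h fin unfolding img by (subst (asm) convex_hull_finite) auto
  let ?u = "\<lambda>j. if j \<in> S then u (?P j) else 0"
  have "sum ?u {..CARD('n)} = (\<Sum>j\<in>S. u (?P j))"
    using S by (intro sum.mono_neutral_cong_right) auto
  moreover have "(\<Sum>j\<le>CARD('n). ?u j *\<^sub>R ?P j) = (\<Sum>j\<in>S. u (?P j) *\<^sub>R ?P j)"
    using S by (intro sum.mono_neutral_cong_right) auto
  ultimately have "is_bary A \<alpha> ?u"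
    using u S unfolding is_bary_def by (auto simp: sum.reindex[OF injP])
  moreover have "pt \<alpha> \<in> convex hull (pt ` A ` {..CARD('n)})"
    using h S hull_mono[of "pt ` A ` S" "pt ` A ` {..CARD('n)}" convex] by blast
  hence "\<exists>!l. is_bary A \<alpha> l" "is_bary A \<alpha> (bary A \<alpha>)"
    using is_bary_bary[of A \<alpha>] A by (simp_all add: even_simplex_def)
  ultimately have "bary A \<alpha> = ?u" by blast
  thus ?thesis using j by simp
qed

lemma in_convex_hull_of_bary_support:
  fixes A :: "nat \<Rightarrow> nat ^ 'n::finite"
  assumes l: "is_bary A \<alpha> l" and S: "S \<subseteq> {..CARD('n)}"
    and z: "\<And>j. j \<le> CARD('n) \<Longrightarrow> j \<notin> S \<Longrightarrow> l j = 0"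
  shows "pt \<alpha> \<in> convex hull (pt ` A ` S)"
proof -
  have "(\<Sum>j\<in>S. l j *\<^sub>R pt (A j)) = (\<Sum>j\<le>CARD('n). l j *\<^sub>R pt (A j))"
    using S z by (intro sum.mono_neutral_left) auto
  also have "\<dots> = pt \<alpha>" using l by (simp add: is_bary_def)
  finally have 1: "(\<Sum>j\<in>S. l j *\<^sub>R pt (A j)) = pt \<alpha>" .
  have "sum l S = sum l {..CARD('n)}"
    using S z by (intro sum.mono_neutral_left) auto
  also have "\<dots> = 1" using l by (simp add: is_bary_def)
  finally have 2: "sum l S = 1" .
  have "(\<Sum>j\<in>S. l j *\<^sub>R pt (A j)) \<in> convex hull (pt ` A ` S)"
    using S 2 l by (intro convex_sum) (auto simp: is_bary_def hull_inc finite_subset[OF S])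
  thus ?thesis using 1 by simp
qed

lemma affine_independent_mem_convex_hull:
  assumes "\<not> affine_dependent T" "S \<subseteq> T" "x \<in> T" "x \<in> convex hull S"
  shows "x \<in> S"
proof (rule ccontr)
  assume "x \<notin> S"
  hence "affine hull S \<subseteq> affine hull (T - {x})" using assms by (intro hull_mono) auto
  moreover have "x \<in> affine hull S" using assms(4) convex_hull_subset_affine_hull by blast
  ultimately show False using assms by (auto simp: affine_dependent_def)
qed

section \<open>Newton polytopes of polynomials in standard form\<close>

lemma finite_nonsquare: "finite (\<Delta> g)"
  by (rule finite_subset[of _ "Poly_Mapping.keys g"]) (auto simp: nonsquare_exps_def in_keys_iff)

lemma nonsquare_not_node:
  "st_standard_form (g :: 'n::finite rpoly) A \<Longrightarrow> j \<le> CARD('n) \<Longrightarrow> A j \<notin> \<Delta> g"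
  by (auto simp: st_standard_form_def nonsquare_exps_def not_less)

lemma nonsquare_ne_0: "\<alpha> \<in> \<Delta> g \<Longrightarrow> coeff_at g \<alpha> \<noteq> 0"
  by (auto simp: nonsquare_exps_def)

lemma st_bary:
  fixes g :: "'n::finite rpoly"
  assumes "st_standard_form g A" "\<alpha> \<in> \<Delta> g"
  shows "is_bary A \<alpha> (bary A \<alpha>)"
  using assms by (intro is_bary_bary_simplex) (auto simp: even_simplex_st st_standard_form_def)

lemma st_bary_pos:
  fixes g :: "'n::finite rpoly"
  assumes "st_standard_form g A" "\<alpha> \<in> \<Delta> g" "j \<in> nz A \<alpha>"
  shows "j \<in> pos_nodes g A" "bary A \<alpha> j > 0"
  using assms st_bary[OF assms(1,2)]
  by (auto simp: st_standard_form_def pos_nodes_def nz_def is_bary_def less_eq_real_def)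

lemma nonsquare_in_hull_pos_nodes:
  assumes "st_standard_form (g :: 'n::finite rpoly) A" "\<alpha> \<in> \<Delta> g"
  shows "pt \<alpha> \<in> convex hull (pt ` A ` pos_nodes g A)"
proof (rule in_convex_hull_of_bary_support[OF st_bary[OF assms]])
  show "bary A \<alpha> j = 0" if "j \<le> CARD('n)" "j \<notin> pos_nodes g A" for j
    using that st_bary_pos(1)[OF assms, of j] by (auto simp: nz_def)
qed (auto simp: pos_nodes_def)

text \<open>
  A node with vanishing coefficient carries no weight of any \<open>\<alpha> \<in> \<Delta> g\<close>, so all of \<open>\<Delta> g\<close> already
  lies in the simplex spanned by the nodes with positive coefficient.
\<close>

lemma newton_st:
  assumes st: "st_standard_form (g :: 'n::finite rpoly) A"
  shows "newton g = convex hull (pt ` A ` pos_nodes g A)"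
proof
  have "pt ` Poly_Mapping.keys g \<subseteq> convex hull (pt ` A ` pos_nodes g A)"
  proof safe
    fix \<beta> assume b: "\<beta> \<in> Poly_Mapping.keys g"
    show "pt \<beta> \<in> convex hull (pt ` A ` pos_nodes g A)"
    proof (cases "\<beta> \<in> \<Delta> g")
      case False
      then obtain j where "\<beta> = A j" "j \<le> CARD('n)" 
        using b st by (auto simp: st_standard_form_def)
      with b st have "j \<in> pos_nodes g A" 
        by (auto simp: st_standard_form_def pos_nodes_def in_keys_iff less_eq_real_def)
      thus ?thesis using \<open>\<beta> = A j\<close> by (auto intro: hull_inc)
    qed (use nonsquare_in_hull_pos_nodes[OF st] in auto)
  qed
  thus "newton g \<subseteq> convex hull (pt ` A ` pos_nodes g A)"
    unfolding newton_def by (simp add: subset_hull)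
  show "convex hull (pt ` A ` pos_nodes g A) \<subseteq> newton g"
    unfolding newton_def by (intro hull_mono) (auto simp: pos_nodes_def in_keys_iff)
qed

lemma pos_nodes_independent:
  assumes "even_simplex (A :: nat \<Rightarrow> nat ^ 'n::finite)" "J \<subseteq> {..CARD('n)}"
  shows "\<not> affine_dependent (pt ` A ` J)"
  using assms affine_dependent_subset[of "pt ` A ` J" "pt ` A ` {..CARD('n)}"]
  by (auto simp: even_simplex_def image_mono)

lemma newton_vertices_st:
  assumes st: "st_standard_form (g :: 'n::finite rpoly) A"
  shows "newton_vertices g = pt ` A ` pos_nodes g A"
proof -
  have "\<not> affine_dependent (pt ` A ` pos_nodes g A)"
    by (rule pos_nodes_independent[OF even_simplex_st[OF st]]) (auto simp: pos_nodes_def)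
  thus ?thesis unfolding newton_vertices_def newton_st[OF st]
    by (auto simp: extreme_point_of_convex_hull_affine_independent)
qed

lemma hull_0_newton_vertices:
  assumes st: "st_standard_form (f :: 'n::finite rpoly) A"
  shows "{0} \<union> newton_vertices f = pt ` A ` insert 0 (pos_nodes f A)"
  using st by (simp add: newton_vertices_st st_standard_form_def)

lemma newton_face_st:
  assumes f: "st_standard_form (f :: 'n::finite rpoly) A" and g: "st_standard_form g A"
    and sub: "pos_nodes g A \<subseteq> insert 0 (pos_nodes f A)"
  shows "newton g face_of convex hull ({0} \<union> newton_vertices f)"
proof -
  have "\<not> affine_dependent (pt ` A ` insert 0 (pos_nodes f A))"
    by (rule pos_nodes_independent[OF even_simplex_st[OF f]]) (auto simp: pos_nodes_def)
  thus ?thesis unfolding hull_0_newton_vertices[OF f] newton_st[OF g]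
    by (subst face_of_convex_hull_affine_independent)
      (use sub in \<open>auto intro!: exI[of _ "pt ` A ` pos_nodes g A"]\<close>)
qed

text \<open>
  Both the polytope of \<open>f\<close> and the Newton polytope of \<open>g\<close> are simplices, and a simplex determines
  its vertices.  The vertices of \<open>newton g\<close> are the positive nodes of \<open>g\<close> in \<open>B\<close>; as a face of the
  larger simplex, \<open>newton g\<close> has vertices among the nodes in \<open>A\<close>.  Thus the relevant nodes of \<open>B\<close>
  are nodes of \<open>A\<close>, and all other nodes of \<open>A\<close> have coefficient 0 in \<open>g\<close>, since they
  lie outside \<open>newton g\<close>.  In this way the node systems of all summands of a decomposition
  can be replaced by a single one.
\<close>

lemma st_standard_form_transfer:
  fixes f g :: "'n::finite rpoly"
  assumes f: "st_standard_form f A" and g: "st_standard_form g B"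
    and face: "newton g face_of convex hull ({0} \<union> newton_vertices f)"
  shows "st_standard_form g A"
proof -
  note A = even_simplex_st[OF f] and B = even_simplex_st[OF g]
  have indep: "\<not> affine_dependent (pt ` A ` insert 0 (pos_nodes f A))"
    by (rule pos_nodes_independent[OF A]) (auto simp: pos_nodes_def)
  obtain c where c: "c \<subseteq> pt ` A ` insert 0 (pos_nodes f A)" "newton g = convex hull c"
    using face indep unfolding hull_0_newton_vertices[OF f]
    by (subst (asm) face_of_convex_hull_affine_independent) auto
  have "newton_vertices g = c"
    unfolding newton_vertices_def c(2)
    using extreme_point_of_convex_hull_affine_independent[OF affine_independent_subset[OF indep c(1)]]
    by auto
  hence cB: "c = pt ` B ` pos_nodes g B" using newton_vertices_st[OF g] by simp
  define S where "S = {j. j \<le> CARD('n) \<and> pt (A j) \<in> c}"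
  have cA: "c = pt ` A ` S" using c(1) by (auto simp: S_def pos_nodes_def)
  have cAll: "c \<subseteq> pt ` A ` {..CARD('n)}" using c(1) by (auto simp: pos_nodes_def)
  have AB: "\<exists>i\<in>pos_nodes g B. A j = B i" if "j \<in> S" for j
    using that cB inj_pt by (auto simp: S_def inj_def)
  have hullc: "pt \<beta> \<in> convex hull c" if "\<beta> \<in> Poly_Mapping.keys g" for \<beta>
    using that c(2) unfolding newton_def by (metis hull_inc imageI)
  have Spos: "coeff_at g (A j) > 0" if "j \<in> S" for j
    using AB[OF that] by (auto simp: pos_nodes_def)
  have Sneg: "coeff_at g (A j) = 0" if "j \<le> CARD('n)" "j \<notin> S" for j
  proof (rule ccontr)
    assume "coeff_at g (A j) \<noteq> 0"
    hence "pt (A j) \<in> convex hull c" using hullc by (simp add: in_keys_iff)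
    moreover have "\<not> affine_dependent (pt ` A ` {..CARD('n)})" using A by (simp add: even_simplex_def)
    ultimately have "pt (A j) \<in> c"
      using affine_independent_mem_convex_hull[OF _ cAll, of "pt (A j)"] that by auto
    thus False using that by (simp add: S_def)
  qed
  have keys: "Poly_Mapping.keys g \<subseteq> A ` {..CARD('n)} \<union> \<Delta> g"
  proof
    fix \<beta> assume b: "\<beta> \<in> Poly_Mapping.keys g"
    show "\<beta> \<in> A ` {..CARD('n)} \<union> \<Delta> g"
    proof (cases "\<beta> \<in> \<Delta> g")
      case False
      then obtain i where i: "\<beta> = B i" "i \<le> CARD('n)" 
        using b g by (auto simp: st_standard_form_def)
      with b g have "i \<in> pos_nodes g B" 
        by (auto simp: st_standard_form_def pos_nodes_def in_keys_iff less_eq_real_def)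
      hence "pt \<beta> \<in> pt ` A ` S" using i cB cA by auto
      thus ?thesis using inj_pt by (auto simp: inj_def S_def)
    qed auto
  qed
  have nonsq: "pt \<alpha> \<in> convex hull (pt ` A ` S)" if "\<alpha> \<in> \<Delta> g" for \<alpha>
    using nonsquare_in_hull_pos_nodes[OF g that] cA cB by simp
  have "pt ` \<Delta> g \<subseteq> convex hull (pt ` A ` {..CARD('n)})"
    using nonsq hull_mono[OF cAll, of convex] cA by blast
  moreover have "bary A \<alpha> j = 0" if "j \<le> CARD('n)" "coeff_at g (A j) = 0" "\<alpha> \<in> \<Delta> g" for \<alpha> j
    using Spos[of j] that nonsq[OF that(3)]
    by (intro bary_eq_0_outside_face[OF A, of S]) (auto simp: S_def)
  moreover have "coeff_at g (A j) \<ge> 0" if "j \<le> CARD('n)" for j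
    using Spos[of j] Sneg[of j] that by (cases "j \<in> S") auto
  ultimately show ?thesis using A keys by (auto simp: st_standard_form_def even_simplex_def)
qed

section \<open>Nonnegativity and the circuit number\<close>

lemma eval_poly_st:
  assumes st: "st_standard_form (g :: 'n::finite rpoly) A"
  shows "eval_poly g x = (\<Sum>j\<le>CARD('n). coeff_at g (A j) * monom_at x (A j)) +
                         (\<Sum>\<alpha>\<in>\<Delta> g. coeff_at g \<alpha> * monom_at x \<alpha>)"
proof -
  let ?t = "\<lambda>\<beta>. coeff_at g \<beta> * monom_at x \<beta>"
  have inj: "inj_on A {..CARD('n)}" using st by (simp add: st_standard_form_def)
  have "eval_poly g x = sum ?t (Poly_Mapping.keys g)"
    by (simp add: eval_poly_def monom_at_def)
  also have "\<dots> = sum ?t (A ` {..CARD('n)} \<union> \<Delta> g)"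
    using st by (intro sum.mono_neutral_left)
      (auto simp: st_standard_form_def in_keys_iff finite_nonsquare)
  also have "\<dots> = sum ?t (A ` {..CARD('n)}) + sum ?t (\<Delta> g)"
    using nonsquare_not_node[OF st] by (intro sum.union_disjoint) (auto simp: finite_nonsquare)
  also have "sum ?t (A ` {..CARD('n)}) = (\<Sum>j\<le>CARD('n). ?t (A j))"
    by (simp add: sum.reindex[OF inj])
  finally show ?thesis .
qed

text \<open>
  Points with vanishing coordinates are included because \<open>ln 0 = 0\<close>: such a coordinate contributes
  the factor \<open>exp 0 = 1\<close>, which agrees with \<open>0 ^ 0\<close>.
\<close>

lemma abs_monom_at_exp:
  assumes "\<And>i. x $ i = 0 \<Longrightarrow> \<beta> $ i = 0"
  shows "\<bar>monom_at x \<beta>\<bar> = exp ((\<chi> i. ln \<bar>x $ i\<bar>) \<bullet> pt \<beta>)"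
proof -
  have "\<bar>x $ i\<bar> ^ (\<beta> $ i) = exp (ln \<bar>x $ i\<bar> * real (\<beta> $ i))" for i
  proof (cases "x $ i = 0")
    case False
    thus ?thesis by (simp add: exp_of_nat2_mult)
  qed (use assms in auto)
  thus ?thesis
    by (simp add: monom_at_def inner_vec_def pt_def exp_sum abs_prod power_abs)
qed

lemma monom_at_even_nonneg: "even_exp \<beta> \<Longrightarrow> monom_at x \<beta> \<ge> 0"
  unfolding monom_at_def by (intro prod_nonneg) (auto simp: even_exp_def zero_le_even_power)

lemma sum_bary_nz:
  fixes A :: "nat \<Rightarrow> nat ^ 'n::finite"
  assumes "is_bary A \<alpha> (bary A \<alpha>)"
  shows "sum (bary A \<alpha>) (nz A \<alpha>) = 1"
proof -
  have "sum (bary A \<alpha>) (nz A \<alpha>) = sum (bary A \<alpha>) {..CARD('n)}"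
    by (intro sum.mono_neutral_left) (auto simp: nz_def)
  thus ?thesis using assms by (simp add: is_bary_def)
qed

lemma finite_nz: "finite (nz A \<alpha>)"
  by (simp add: nz_def)

lemma prod_nz_split_0:
  assumes "0 \<in> nz A \<alpha>"
  shows "prod h (nz A \<alpha>) = h 0 * prod h {j\<in>nz A \<alpha>. j \<ge> 1}"
proof -
  have "nz A \<alpha> - {0} = {j\<in>nz A \<alpha>. j \<ge> 1}" by auto
  thus ?thesis using prod.remove[OF finite_nz assms, of h] by simp
qed

lemma nz_without_0: "0 \<notin> nz A \<alpha> \<Longrightarrow> {j\<in>nz A \<alpha>. j \<ge> 1} = nz A \<alpha>"
  by (auto simp: Suc_le_eq intro: gr0I)

text \<open>
  \<open>\<bar>x\<^sup>\<alpha>\<bar>\<close> is the geometric mean of the \<open>x\<^bsup>\<alpha>(j)\<^esup>\<close> with weights \<open>\<lambda>\<^sub>j\<close>, because \<open>ln \<bar>x\<^sup>\<beta>\<bar>\<close> is linear in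
  \<open>\<beta>\<close>.  The product must be restricted to \<open>nz A \<alpha>\<close>: a node outside may vanish at \<open>x\<close>, and
  \<open>0 powr 0 = 0\<close>.
\<close>

lemma abs_monom_at_bary:
  fixes A :: "nat \<Rightarrow> nat ^ 'n::finite"
  assumes A: "even_simplex A" and l: "is_bary A \<alpha> (bary A \<alpha>)" and nonzero: "monom_at x \<alpha> \<noteq> 0"
  shows "\<bar>monom_at x \<alpha>\<bar> = (\<Prod>j\<in>nz A \<alpha>. monom_at x (A j) powr bary A \<alpha> j)"
    and "j \<in> nz A \<alpha> \<Longrightarrow> monom_at x (A j) > 0"
proof -
  have z: "\<alpha> $ i = 0" if "x $ i = 0" for i
    using nonzero that by (auto simp: monom_at_def)
  \<comment> \<open>All weights and exponents are nonnegative, so a variable missing from \<open>x\<^sup>\<alpha>\<close> is missing from every node that carries weight.\<close>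
  have z': "A j $ i = 0" if "x $ i = 0" "j \<in> nz A \<alpha>" for i j
  proof -
    have "(\<Sum>j\<le>CARD('n). bary A \<alpha> j * real (A j $ i)) = pt \<alpha> $ i"
      using l unfolding is_bary_def by (auto simp: pt_def dest!: arg_cong[of _ _ "\<lambda>v. v $ i"])
    also have "\<dots> = 0" using z[OF that(1)] by (simp add: pt_def)
    finally have "bary A \<alpha> j * real (A j $ i) = 0"
      using l that(2) by (subst (asm) sum_nonneg_eq_0_iff) (auto simp: is_bary_def nz_def)
    thus ?thesis using that(2) by (auto simp: nz_def)
  qed
  let ?w = "\<chi> i. ln \<bar>x $ i\<bar>"
  have node: "monom_at x (A j) = exp (?w \<bullet> pt (A j))" if "j \<in> nz A \<alpha>" for j
  proof -
    have "even_exp (A j)" using A that by (auto simp: even_simplex_def nz_def)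
    hence "monom_at x (A j) = \<bar>monom_at x (A j)\<bar>" using monom_at_even_nonneg by fastforce
    also have "\<dots> = exp (?w \<bullet> pt (A j))" using z' that by (intro abs_monom_at_exp) auto
    finally show ?thesis .
  qed
  show "j \<in> nz A \<alpha> \<Longrightarrow> monom_at x (A j) > 0" using node by simp
  have "pt \<alpha> = (\<Sum>j\<in>nz A \<alpha>. bary A \<alpha> j *\<^sub>R pt (A j))"
  proof -
    have "(\<Sum>j\<in>nz A \<alpha>. bary A \<alpha> j *\<^sub>R pt (A j)) = (\<Sum>j\<le>CARD('n). bary A \<alpha> j *\<^sub>R pt (A j))"
      by (intro sum.mono_neutral_left) (auto simp: nz_def)
    thus ?thesis using l by (simp add: is_bary_def)
  qed
  hence "\<bar>monom_at x \<alpha>\<bar> = exp (\<Sum>j\<in>nz A \<alpha>. bary A \<alpha> j * (?w \<bullet> pt (A j)))"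
    using abs_monom_at_exp[of x \<alpha>] z by (simp add: inner_sum_right)
  also have "\<dots> = (\<Prod>j\<in>nz A \<alpha>. monom_at x (A j) powr bary A \<alpha> j)"
    by (auto simp: exp_sum[OF finite_nz] node powr_def intro!: prod.cong)
  finally show "\<bar>monom_at x \<alpha>\<bar> = (\<Prod>j\<in>nz A \<alpha>. monom_at x (A j) powr bary A \<alpha> j)" .
qed

text \<open>
  The differences of affinely independent nodes to the node \<open>0\<close> are linearly independent, so a
  linear functional can take any prescribed values on them; its representing vector is \<open>w\<close>.
  Applied to logarithms, this says that the values of the monomials \<open>x\<^bsup>\<alpha>(j)\<^esup>\<close>, \<open>j \<ge> 1\<close>, are arbitrary
  positive numbers.
\<close>

lemma exists_log_point:
  fixes A :: "nat \<Rightarrow> nat ^ 'n::finite" and h :: "nat \<Rightarrow> real"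
  assumes A: "even_simplex A" and h0: "h 0 = 0"
  obtains w where "\<And>j. j \<le> CARD('n) \<Longrightarrow> w \<bullet> pt (A j) = h j"
proof -
  let ?P = "\<lambda>j. pt (A j)" and ?I = "{1..CARD('n)}"
  have I: "{..CARD('n)} = insert 0 ?I" by auto
  have A0: "A 0 = 0" using A by (simp add: even_simplex_def)
  have injP: "inj_on ?P {..CARD('n)}"
    by (rule inj_on_pt_nodes[OF A])
  have "\<not> affine_dependent (insert 0 (?P ` ?I))"
    using A A0 by (simp add: even_simplex_def I image_image)
  moreover have "0 \<notin> ?P ` ?I"
  proof
    assume "0 \<in> ?P ` ?I"
    then obtain j where "j \<in> ?I" "?P j = ?P 0" using A0 by auto
    thus False using injP by (auto simp: inj_on_def)
  qed
  ultimately have "independent (?P ` ?I)"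
    by (subst (asm) affine_dependent_iff_dependent) auto
  then obtain \<phi> :: "real ^ 'n \<Rightarrow> real"
    where \<phi>: "linear \<phi>" "\<And>y. y \<in> ?P ` ?I \<Longrightarrow> \<phi> y = h (inv_into ?I ?P y)"
    using linear_independent_extend[of "?P ` ?I" "\<lambda>y. h (inv_into ?I ?P y)"] by blast
  have injI: "inj_on ?P ?I" using injP by (rule inj_on_subset) auto
  have "adjoint \<phi> 1 \<bullet> ?P j = h j" if "j \<le> CARD('n)" for j
  proof (cases "j = 0")
    case False
    hence "j \<in> ?I" using that by auto
    hence "\<phi> (?P j) = h j" using \<phi>(2)[of "?P j"] inv_into_f_f[OF injI] by auto
    thus ?thesis using adjoint_works[OF \<phi>(1), of "?P j" 1] by (simp add: inner_commute)
  qed (simp add: A0 h0)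
  thus ?thesis by (rule that)
qed

text \<open>
  A negative coefficient needs the positive orthant only; a positive one comes with an odd exponent,
  and reflecting that coordinate makes \<open>x\<^sup>\<alpha>\<close> negative without affecting any even monomial.
\<close>

lemma exists_sign_pattern:
  fixes w :: "real ^ 'n::finite"
  assumes a: "\<alpha> \<in> \<Delta> g"
  obtains x where "\<And>i. \<bar>x $ i\<bar> = exp (w $ i)"
    "coeff_at g \<alpha> * monom_at x \<alpha> = - (\<bar>coeff_at g \<alpha>\<bar> * \<bar>monom_at x \<alpha>\<bar>)"
proof (cases "coeff_at g \<alpha> < 0")
  case True
  let ?x = "\<chi> i. exp (w $ i)"
  have "monom_at ?x \<alpha> \<ge> 0" unfolding monom_at_def by (intro prod_nonneg) auto
  thus ?thesis using True by (intro that[of ?x]) auto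
next
  case False
  then obtain i where i: "odd (\<alpha> $ i)" and c: "coeff_at g \<alpha> > 0"
    using a by (auto simp: nonsquare_exps_def even_exp_def)
  let ?x = "\<chi> k. if k = i then - exp (w $ k) else exp (w $ k)"
  have "monom_at ?x \<alpha> = (- exp (w $ i)) ^ (\<alpha> $ i) * (\<Prod>k\<in>UNIV - {i}. (?x $ k) ^ (\<alpha> $ k))"
    unfolding monom_at_def by (subst prod.remove[of _ i]) auto
  also have "(\<Prod>k\<in>UNIV - {i}. (?x $ k) ^ (\<alpha> $ k)) = (\<Prod>k\<in>UNIV - {i}. exp (w $ k) ^ (\<alpha> $ k))"
    by (intro prod.cong) auto
  also have "(- exp (w $ i)) ^ (\<alpha> $ i) * \<dots> \<le> 0"
    using i by (intro mult_nonpos_nonneg prod_nonneg) auto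
  finally show ?thesis using c by (intro that[of ?x]) auto
qed

text \<open>
  The inequality is homogeneous of degree 1 in \<open>v\<close>, so it suffices to have it for the ratios
  \<open>v\<^sub>j / v\<^sub>0\<close>, and these are the monomial values at a suitable point \<open>x\<close>.  Unlike the circuit
  number condition, this form is linear in the coefficients of \<open>g\<close> at the nodes and can be summed over
  several polynomials with the same \<open>\<alpha>\<close>.
\<close>

lemma nonneg_st_imp_bound:
  fixes g :: "'n::finite rpoly"
  assumes st: "st_standard_form g A" and D: "\<Delta> g = {\<alpha>}" and nn: "nonneg_poly g"
    and v: "\<And>j. j \<le> CARD('n) \<Longrightarrow> v j > 0"
  shows "\<bar>coeff_at g \<alpha>\<bar> * (\<Prod>j\<in>nz A \<alpha>. v j powr bary A \<alpha> j)
           \<le> (\<Sum>j\<le>CARD('n). coeff_at g (A j) * v j)"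
proof -
  note A = even_simplex_st[OF st]
  have a: "\<alpha> \<in> \<Delta> g" using D by simp
  note l = st_bary[OF st a]
  have v0: "v 0 > 0" using v by simp
  obtain w where w: "\<And>j. j \<le> CARD('n) \<Longrightarrow> w \<bullet> pt (A j) = ln (v j / v 0)"
    using exists_log_point[OF A, of "\<lambda>j. ln (v j / v 0)"] v0 by auto
  obtain x where x: "\<And>i. \<bar>x $ i\<bar> = exp (w $ i)"
    and sgn: "coeff_at g \<alpha> * monom_at x \<alpha> = - (\<bar>coeff_at g \<alpha>\<bar> * \<bar>monom_at x \<alpha>\<bar>)"
    using exists_sign_pattern[OF a] by blast
  have x0: "x $ i \<noteq> 0" for i using x[of i] by auto
  have lnx: "(\<chi> i. ln \<bar>x $ i\<bar>) = w" by (simp add: x vec_eq_iff)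
  have node: "monom_at x (A j) = v j / v 0" if "j \<le> CARD('n)" for j
  proof -
    have "even_exp (A j)" using A that by (auto simp: even_simplex_def)
    hence "monom_at x (A j) = \<bar>monom_at x (A j)\<bar>" using monom_at_even_nonneg by fastforce
    also have "\<dots> = exp (w \<bullet> pt (A j))" using abs_monom_at_exp[of x "A j"] x0 lnx by simp
    also have "\<dots> = v j / v 0" using w[OF that] v[OF that] v0 by simp
    finally show ?thesis .
  qed
  have "monom_at x \<alpha> \<noteq> 0" using x0 by (simp add: monom_at_def)
  hence "\<bar>monom_at x \<alpha>\<bar> = (\<Prod>j\<in>nz A \<alpha>. monom_at x (A j) powr bary A \<alpha> j)"
    by (rule abs_monom_at_bary(1)[OF A l])
  also have "\<dots> = (\<Prod>j\<in>nz A \<alpha>. v j powr bary A \<alpha> j / v 0 powr bary A \<alpha> j)"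
    by (intro prod.cong) (auto simp: node powr_divide nz_def)
  also have "\<dots> = (\<Prod>j\<in>nz A \<alpha>. v j powr bary A \<alpha> j) / v 0"
    using v0 by (simp add: prod_dividef powr_sum[symmetric] sum_bary_nz[OF l])
  finally have al: "\<bar>monom_at x \<alpha>\<bar> = (\<Prod>j\<in>nz A \<alpha>. v j powr bary A \<alpha> j) / v 0" .
  have "0 \<le> eval_poly g x" using nn by (simp add: nonneg_poly_def)
  also have "\<dots> = (\<Sum>j\<le>CARD('n). coeff_at g (A j) * (v j / v 0)) - \<bar>coeff_at g \<alpha>\<bar> * \<bar>monom_at x \<alpha>\<bar>"
    unfolding eval_poly_st[OF st] D by (simp add: sgn node)
  also have "\<dots> = ((\<Sum>j\<le>CARD('n). coeff_at g (A j) * v j) -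
                   \<bar>coeff_at g \<alpha>\<bar> * (\<Prod>j\<in>nz A \<alpha>. v j powr bary A \<alpha> j)) / v 0"
    unfolding al by (simp add: sum_divide_distrib diff_divide_distrib)
  finally show ?thesis using v0 by (simp add: zero_le_divide_iff)
qed

lemma circuit_number_imp_nonneg:
  fixes g :: "'n::finite rpoly"
  assumes st: "st_standard_form g A" and D: "\<Delta> g \<subseteq> {\<alpha>}"
    and c: "\<alpha> \<in> \<Delta> g \<Longrightarrow>
          \<bar>coeff_at g \<alpha>\<bar> \<le> (\<Prod>j\<in>nz A \<alpha>. (coeff_at g (A j) / bary A \<alpha> j) powr bary A \<alpha> j)"
  shows "nonneg_poly g"
  unfolding nonneg_poly_def
proof
  fix x
  note A = even_simplex_st[OF st]
  let ?t = "\<lambda>j. coeff_at g (A j) * monom_at x (A j)"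
  have nodes: "?t j \<ge> 0" if "j \<le> CARD('n)" for j
    using st that by (intro mult_nonneg_nonneg monom_at_even_nonneg) (auto simp: st_standard_form_def)
  have "- (\<Sum>\<alpha>\<in>\<Delta> g. coeff_at g \<alpha> * monom_at x \<alpha>) \<le> (\<Sum>j\<le>CARD('n). ?t j)"
  proof (cases "\<alpha> \<in> \<Delta> g \<and> monom_at x \<alpha> \<noteq> 0")
    case True
    hence a: "\<alpha> \<in> \<Delta> g" and m: "monom_at x \<alpha> \<noteq> 0" by auto
    note l = st_bary[OF st a]
    have "- (\<Sum>\<alpha>\<in>\<Delta> g. coeff_at g \<alpha> * monom_at x \<alpha>) \<le> \<bar>coeff_at g \<alpha>\<bar> * \<bar>monom_at x \<alpha>\<bar>"
    proof -
      have "\<Delta> g = {\<alpha>}" using D a by blast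
      thus ?thesis using abs_ge_minus_self[of "coeff_at g \<alpha> * monom_at x \<alpha>"] by (simp add: abs_mult)
    qed
    also have "\<dots> = \<bar>coeff_at g \<alpha>\<bar> * (\<Prod>j\<in>nz A \<alpha>. monom_at x (A j) powr bary A \<alpha> j)"
      by (simp add: abs_monom_at_bary(1)[OF A l m])
    also have "\<dots> \<le> (\<Sum>j\<in>nz A \<alpha>. ?t j)"
      using st_bary_pos[OF st a] abs_monom_at_bary(2)[OF A l m]
      by (intro circuit_number_imp_bound[OF finite_nz _ sum_bary_nz[OF l]] c a)
         (auto simp: pos_nodes_def)
    also have "\<dots> \<le> (\<Sum>j\<le>CARD('n). ?t j)"
      by (rule sum_mono2) (auto simp: nz_def nodes)
    finally show ?thesis .
  next
    case False
    hence "(\<Sum>\<alpha>\<in>\<Delta> g. coeff_at g \<alpha> * monom_at x \<alpha>) = 0" using D by (intro sum.neutral) auto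
    moreover have "(\<Sum>j\<le>CARD('n). ?t j) \<ge> 0" by (rule sum_nonneg, rule nodes) simp
    ultimately show ?thesis by linarith
  qed
  thus "0 \<le> eval_poly g x" unfolding eval_poly_st[OF st] by linarith
qed

section \<open>Circuit polynomials with prescribed coefficients\<close>

definition circuit_of :: "(nat \<Rightarrow> nat ^ 'n::finite) \<Rightarrow> (nat \<Rightarrow> real) \<Rightarrow> nat ^ 'n \<Rightarrow> real \<Rightarrow> 'n rpoly" where
  "circuit_of A b \<alpha> c = (\<Sum>j\<le>CARD('n). Poly_Mapping.single (A j) (b j)) + Poly_Mapping.single \<alpha> c"

lemma coeff_circuit_of_node:
  fixes A :: "nat \<Rightarrow> nat ^ 'n::finite"
  assumes A: "even_simplex A" and i: "i \<le> CARD('n)" and "c \<noteq> 0 \<Longrightarrow> \<alpha> \<notin> A ` {..CARD('n)}"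
  shows "coeff_at (circuit_of A b \<alpha> c) (A i) = b i"
proof -
  have "(\<Sum>j\<le>CARD('n). coeff_at (Poly_Mapping.single (A j) (b j)) (A i))
        = (\<Sum>j\<le>CARD('n). if j = i then b j else 0)"
    using even_simplex_injD[OF A _ _ i] by (intro sum.cong) (auto simp: lookup_single when_def)
  also have "\<dots> = b i" using i by simp
  finally show ?thesis using assms(3) i
    by (cases "c = 0") (auto simp: circuit_of_def lookup_add lookup_sum lookup_single when_def)
qed

lemma coeff_circuit_of_other:
  fixes A :: "nat \<Rightarrow> nat ^ 'n::finite"
  assumes "\<beta> \<notin> A ` {..CARD('n)}"
  shows "coeff_at (circuit_of A b \<alpha> c) \<beta> = (if \<beta> = \<alpha> then c else 0)"
  using assms by (auto simp: circuit_of_def lookup_add lookup_sum lookup_single when_def intro!: sum.neutral)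

lemma st_circuit_of:
  fixes A :: "nat \<Rightarrow> nat ^ 'n::finite"
  assumes A: "even_simplex A" and b: "\<And>j. j \<le> CARD('n) \<Longrightarrow> b j \<ge> 0"
    and node: "c \<noteq> 0 \<Longrightarrow> \<alpha> \<notin> A ` {..CARD('n)}"
    and nonsq: "c \<noteq> 0 \<Longrightarrow> c < 0 \<or> \<not> even_exp \<alpha>"
    and hull: "c \<noteq> 0 \<Longrightarrow> pt \<alpha> \<in> convex hull (pt ` A ` {..CARD('n)})"
    and supp: "\<And>j. c \<noteq> 0 \<Longrightarrow> j \<in> nz A \<alpha> \<Longrightarrow> b j \<noteq> 0"
  shows "st_standard_form (circuit_of A b \<alpha> c) A"
    and "\<Delta> (circuit_of A b \<alpha> c) = (if c = 0 then {} else {\<alpha>})"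
proof -
  let ?g = "circuit_of A b \<alpha> c"
  have cn: "coeff_at ?g (A j) = b j" if "j \<le> CARD('n)" for j
    by (rule coeff_circuit_of_node[OF A that node])
  have ev: "even_exp (A j)" if "j \<le> CARD('n)" for j using A that by (simp add: even_simplex_def)
  have notin: "\<beta> \<notin> \<Delta> ?g" if "\<beta> \<in> A ` {..CARD('n)}" for \<beta>
    using that cn b ev by (auto simp: nonsquare_exps_def not_less)
  have "\<beta> \<in> \<Delta> ?g \<longleftrightarrow> c \<noteq> 0 \<and> \<beta> = \<alpha>" for \<beta>
  proof (cases "\<beta> \<in> A ` {..CARD('n)}")
    case False
    thus ?thesis using nonsq by (auto simp: nonsquare_exps_def coeff_circuit_of_other[OF False])
  qed (use notin node in auto)
  thus D: "\<Delta> ?g = (if c = 0 then {} else {\<alpha>})" by auto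
  have "Poly_Mapping.keys ?g \<subseteq> A ` {..CARD('n)} \<union> \<Delta> ?g"
  proof
    fix \<beta> assume "\<beta> \<in> Poly_Mapping.keys ?g"
    thus "\<beta> \<in> A ` {..CARD('n)} \<union> \<Delta> ?g" unfolding D
      by (cases "\<beta> \<in> A ` {..CARD('n)}") (auto simp: in_keys_iff coeff_circuit_of_other split: if_splits)
  qed
  thus "st_standard_form ?g A"
    using A b cn hull supp unfolding st_standard_form_def even_simplex_def D
    by (auto simp: nz_def)
qed

section \<open>The two feasible sets coincide\<close>

lemma coeff_const_poly: "coeff_at (const_poly r) \<beta> = (if \<beta> = 0 then r else 0)"
  by (simp add: const_poly_def lookup_single when_def)

text \<open>
  Each \<open>\<alpha> \<in> \<Delta> f\<close> receives the circuit polynomial with node coefficients \<open>a\<^sub>\<alpha>\<^sub>,\<^sub>j\<close> and the least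
  constant term that keeps it nonnegative.  Only the \<open>a\<^sub>\<alpha>\<^sub>,\<^sub>j\<close> with \<open>\<lambda>\<^sub>j > 0\<close> are used, so that the Newton
  polytope is the face spanned by \<open>nz \<alpha>\<close>; everything else goes to the remainder \<open>R\<close>, whose
  coefficients \<open>d\<^sub>j\<close> are nonnegative by conditions (2) and (3).
\<close>

lemma gp1_feasible_imp_gp2_feasible:
  fixes f :: "'n::finite rpoly"
  assumes st: "st_standard_form f A" and feas: "gp1_feasible f A r a"
  shows "gp2_feasible f r"
proof -
  note A = even_simplex_st[OF st]
  have A0: "A 0 = 0" using A by (simp add: even_simplex_def)
  define C where "C \<alpha> = bary A \<alpha> 0 * \<bar>coeff_at f \<alpha>\<bar> powr (1 / bary A \<alpha> 0) *
          (\<Prod>j\<in>{j\<in>nz A \<alpha>. j \<ge> 1}. (bary A \<alpha> j / a \<alpha> j) powr (bary A \<alpha> j / bary A \<alpha> 0))" for \<alpha>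
  define b where "b \<alpha> j = (if j \<notin> nz A \<alpha> then 0 else if j = 0 then C \<alpha> else a \<alpha> j)" for \<alpha> j
  have f1: "a \<alpha> j \<ge> 0" if "\<alpha> \<in> \<Delta> f" "1 \<le> j" "j \<le> CARD('n)" for \<alpha> j
    using feas that by (auto simp: gp1_feasible_def)
  have f2: "a \<alpha> j > 0" if "\<alpha> \<in> \<Delta> f" "1 \<le> j" "j \<in> nz A \<alpha>" for \<alpha> j
    using feas that st_bary_pos(2)[OF st that(1,3)] by (auto simp: gp1_feasible_def nz_def)
  have f3: "\<bar>coeff_at f \<alpha>\<bar> \<le> (\<Prod>j\<in>{j\<in>nz A \<alpha>. j \<ge> 1}. (a \<alpha> j / bary A \<alpha> j) powr bary A \<alpha> j)"
    if "\<alpha> \<in> \<Delta> f" "bary A \<alpha> 0 = 0" for \<alpha>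
    using feas that by (auto simp: gp1_feasible_def)
  have f4: "(\<Sum>\<alpha>\<in>\<Delta> f. a \<alpha> j) \<le> coeff_at f (A j)" if "1 \<le> j" "j \<le> CARD('n)" for j
    using feas that by (auto simp: gp1_feasible_def)
  have f5: "(\<Sum>\<alpha>\<in>{\<alpha>\<in>\<Delta> f. 0 \<in> nz A \<alpha>}. C \<alpha>) \<le> coeff_at f 0 - r"
    using feas by (auto simp: gp1_feasible_def C_def)
  have Cpos: "C \<alpha> > 0" if al: "\<alpha> \<in> \<Delta> f" and "0 \<in> nz A \<alpha>" for \<alpha>
  proof -
    have "bary A \<alpha> j / a \<alpha> j > 0" if "j \<in> {j\<in>nz A \<alpha>. j \<ge> 1}" for j
      using st_bary_pos(2)[OF st al] f2[OF al] that by (intro divide_pos_pos) auto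
    hence "(bary A \<alpha> j / a \<alpha> j) powr (bary A \<alpha> j / bary A \<alpha> 0) > 0"
      if "j \<in> {j\<in>nz A \<alpha>. j \<ge> 1}" for j
      using that by (metis powr_gt_zero less_irrefl)
    thus ?thesis unfolding C_def
      using st_bary_pos(2)[OF st al] nonsquare_ne_0[OF al] \<open>0 \<in> nz A \<alpha>\<close>
      by (intro mult_pos_pos prod_pos) auto
  qed
  have bpos: "b \<alpha> j > 0" if "\<alpha> \<in> \<Delta> f" "j \<in> nz A \<alpha>" for \<alpha> j
    using that f2[OF that(1)] Cpos[OF that(1)] by (auto simp: b_def)
  have bnn: "b \<alpha> j \<ge> 0" if "\<alpha> \<in> \<Delta> f" for \<alpha> j
    using bpos[OF that, of j] by (cases "j \<in> nz A \<alpha>") (auto simp: b_def)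
  define G where "G \<alpha> = circuit_of A (b \<alpha>) \<alpha> (coeff_at f \<alpha>)" for \<alpha>
  have node: "\<alpha> \<notin> A ` {..CARD('n)}" if "\<alpha> \<in> \<Delta> f" for \<alpha>
    using nonsquare_not_node[OF st] that by auto
  have Gst: "st_standard_form (G \<alpha>) A" and GD: "\<Delta> (G \<alpha>) = {\<alpha>}" if al: "\<alpha> \<in> \<Delta> f" for \<alpha>
  proof -
    have "b \<alpha> j \<noteq> 0" if "j \<in> nz A \<alpha>" for j using bpos[OF al that] by simp
    moreover have "coeff_at f \<alpha> < 0 \<or> \<not> even_exp \<alpha>" using al by (auto simp: nonsquare_exps_def)
    moreover have "pt \<alpha> \<in> convex hull (pt ` A ` {..CARD('n)})"
      using st that by (auto simp: st_standard_form_def)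
    ultimately show "st_standard_form (G \<alpha>) A" "\<Delta> (G \<alpha>) = {\<alpha>}"
      using st_circuit_of[OF A, of "b \<alpha>" "coeff_at f \<alpha>" \<alpha>] bnn[OF that] node[OF that]
        nonsquare_ne_0[OF that]
      by (simp_all add: G_def)
  qed
  have Gnode: "coeff_at (G \<alpha>) (A j) = b \<alpha> j" if "\<alpha> \<in> \<Delta> f" "j \<le> CARD('n)" for \<alpha> j
    unfolding G_def by (rule coeff_circuit_of_node[OF A that(2) node[OF that(1)]])
  have Gother: "coeff_at (G \<alpha>) \<beta> = (if \<beta> = \<alpha> then coeff_at f \<alpha> else 0)"
    if "\<beta> \<notin> A ` {..CARD('n)}" for \<alpha> \<beta>
    unfolding G_def by (rule coeff_circuit_of_other[OF that])
  have Gnn: "nonneg_poly (G \<alpha>)" if al: "\<alpha> \<in> \<Delta> f" for \<alpha>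
  proof (rule circuit_number_imp_nonneg[OF Gst[OF al], of \<alpha>])
    let ?N = "{j\<in>nz A \<alpha>. j \<ge> 1}"
    have prodN: "(\<Prod>j\<in>?N. (b \<alpha> j / bary A \<alpha> j) powr bary A \<alpha> j)
                = (\<Prod>j\<in>?N. (a \<alpha> j / bary A \<alpha> j) powr bary A \<alpha> j)"
      by (intro prod.cong) (auto simp: b_def)
    have "\<bar>coeff_at f \<alpha>\<bar> \<le> (\<Prod>j\<in>nz A \<alpha>. (b \<alpha> j / bary A \<alpha> j) powr bary A \<alpha> j)"
    proof (cases "0 \<in> nz A \<alpha>")
      case True
      have "(\<Prod>j\<in>nz A \<alpha>. (b \<alpha> j / bary A \<alpha> j) powr bary A \<alpha> j)
        = (C \<alpha> / bary A \<alpha> 0) powr bary A \<alpha> 0 * (\<Prod>j\<in>?N. (a \<alpha> j / bary A \<alpha> j) powr bary A \<alpha> j)"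
        unfolding prod_nz_split_0[OF True] prodN using True by (simp add: b_def)
      moreover have "\<bar>coeff_at f \<alpha>\<bar> \<le> \<dots>"
        using st_bary_pos(2)[OF st al] f2[OF al] True Cpos[OF al True] nonsquare_ne_0[OF al]
        by (subst circuit_number_le_iff_constant_ge) (auto simp: C_def finite_nz)
      ultimately show ?thesis by simp
    next
      case False
      hence "bary A \<alpha> 0 = 0" by (simp add: nz_def)
      thus ?thesis using f3[OF al] prodN nz_without_0[OF False] by simp
    qed
    also have "\<dots> = (\<Prod>j\<in>nz A \<alpha>. (coeff_at (G \<alpha>) (A j) / bary A \<alpha> j) powr bary A \<alpha> j)"
      using Gnode[OF al] by (intro prod.cong) (auto simp: nz_def)
    also have "\<bar>coeff_at f \<alpha>\<bar> = \<bar>coeff_at (G \<alpha>) \<alpha>\<bar>" using Gother[OF node[OF al]] by simp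
    finally show "\<bar>coeff_at (G \<alpha>) \<alpha>\<bar>
      \<le> (\<Prod>j\<in>nz A \<alpha>. (coeff_at (G \<alpha>) (A j) / bary A \<alpha> j) powr bary A \<alpha> j)" .
  qed (use GD[OF al] in auto)
  define d where "d j = coeff_at (f - const_poly r) (A j) - (\<Sum>\<alpha>\<in>\<Delta> f. b \<alpha> j)" for j
  define R where "R = circuit_of A d 0 0"
  have An0: "A j \<noteq> 0" if "1 \<le> j" "j \<le> CARD('n)" for j
    using even_simplex_injD[OF A, of j 0] that A0 by auto
  have dnn: "d j \<ge> 0" if j: "j \<le> CARD('n)" for j
  proof (cases "j = 0")
    case True
    have "(\<Sum>\<alpha>\<in>\<Delta> f. b \<alpha> 0) = (\<Sum>\<alpha>\<in>{\<alpha>\<in>\<Delta> f. 0 \<in> nz A \<alpha>}. C \<alpha>)"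
      by (intro sum.mono_neutral_cong_right) (auto simp: b_def finite_nonsquare)
    thus ?thesis using f5 True by (simp add: d_def lookup_minus coeff_const_poly A0)
  next
    case False
    have "(\<Sum>\<alpha>\<in>\<Delta> f. b \<alpha> j) \<le> (\<Sum>\<alpha>\<in>\<Delta> f. a \<alpha> j)"
      using f1 False j by (intro sum_mono) (auto simp: b_def)
    thus ?thesis using f4[of j] An0[of j] False j by (simp add: d_def lookup_minus coeff_const_poly)
  qed
  have Rst: "st_standard_form R A" and RD: "\<Delta> R = {}"
    using st_circuit_of[OF A, where b = d and c = 0 and \<alpha> = 0] dnn by (auto simp: R_def)
  have Rnode: "coeff_at R (A j) = d j" if "j \<le> CARD('n)" for j
    unfolding R_def by (rule coeff_circuit_of_node[OF A that]) auto
  have Rother: "coeff_at R \<beta> = 0" if "\<beta> \<notin> A ` {..CARD('n)}" for \<beta>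
    unfolding R_def using coeff_circuit_of_other[OF that] by simp
  have Rnn: "nonneg_poly R"
    by (rule circuit_number_imp_nonneg[OF Rst, of 0]) (auto simp: RD)
  have Gface: "newton (G \<alpha>) face_of convex hull ({0} \<union> newton_vertices f)" if "\<alpha> \<in> \<Delta> f" for \<alpha>
  proof (rule newton_face_st[OF st Gst[OF that]], rule subsetI)
    fix j assume "j \<in> pos_nodes (G \<alpha>) A"
    hence "j \<in> nz A \<alpha>" using Gnode[OF that] by (auto simp: pos_nodes_def b_def split: if_splits)
    thus "j \<in> insert 0 (pos_nodes f A)" using st_bary_pos(1)[OF st that] by auto
  qed
  have Rface: "newton R face_of convex hull ({0} \<union> newton_vertices f)"
  proof (rule newton_face_st[OF st Rst], rule subsetI)
    fix j assume "j \<in> pos_nodes R A"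
    hence j: "j \<le> CARD('n)" "d j > 0" using Rnode by (auto simp: pos_nodes_def)
    show "j \<in> insert 0 (pos_nodes f A)"
    proof (cases "j = 0")
      case False
      have "(\<Sum>\<alpha>\<in>\<Delta> f. b \<alpha> j) \<ge> 0" using bnn by (intro sum_nonneg) auto
      hence "coeff_at f (A j) > 0" using j False An0[of j]
        by (simp add: d_def lookup_minus coeff_const_poly)
      thus ?thesis using j by (simp add: pos_nodes_def)
    qed simp
  qed
  have split: "f - const_poly r = (\<Sum>\<alpha>\<in>\<Delta> f. G \<alpha>) + R"
  proof (rule poly_mapping_eqI)
    fix \<beta>
    show "coeff_at (f - const_poly r) \<beta> = coeff_at ((\<Sum>\<alpha>\<in>\<Delta> f. G \<alpha>) + R) \<beta>"
    proof (cases "\<beta> \<in> A ` {..CARD('n)}")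
      case True
      then obtain j where j: "\<beta> = A j" "j \<le> CARD('n)" by auto
      show ?thesis unfolding j(1) using j(2)
        by (simp add: lookup_add lookup_sum Rnode Gnode d_def)
    next
      case False
      hence "\<beta> \<noteq> 0" using A0 by force
      moreover have "\<beta> \<in> \<Delta> f" if "coeff_at f \<beta> \<noteq> 0"
        using st False that by (auto simp: st_standard_form_def in_keys_iff)
      ultimately show ?thesis using False
        by (auto simp: lookup_add lookup_sum lookup_minus coeff_const_poly Rother Gother finite_nonsquare)
    qed
  qed
  obtain h where h: "bij_betw h {1..card (\<Delta> f)} (\<Delta> f)"
    using ex_bij_betw_nat_finite_1[OF finite_nonsquare] by blast
  let ?s = "Suc (card (\<Delta> f))"
  let ?g = "\<lambda>k. if k = ?s then R else G (h k)"
  have "(\<Sum>k=1..?s. ?g k) = (\<Sum>k=1..card (\<Delta> f). G (h k)) + R" by simp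
  also have "(\<Sum>k=1..card (\<Delta> f). G (h k)) = (\<Sum>\<alpha>\<in>\<Delta> f. G \<alpha>)"
    using h by (rule sum.reindex_bij_betw)
  finally have "f - const_poly r = (\<Sum>k=1..?s. ?g k)" using split by simp
  moreover have "circuit_poly (?g k) \<and> nonneg_poly (?g k) \<and>
      newton (?g k) face_of (convex hull ({0} \<union> newton_vertices f))" if "k \<in> {1..?s}" for k
  proof (cases "k = ?s")
    case True
    thus ?thesis using Rst RD Rnn Rface by (auto simp: circuit_poly_def)
  next
    case False
    hence "h k \<in> \<Delta> f" using that h by (auto simp: bij_betw_def)
    thus ?thesis using False Gst[of "h k"] GD[of "h k"] Gnn Gface by (auto simp: circuit_poly_def)
  qed
  ultimately show ?thesis unfolding gp2_feasible_def
    by (intro exI[of _ ?s] exI[of _ ?g]) blast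
qed

text \<open>
  Grouping the \<open>g\<^sub>k\<close> by the exponent in \<open>\<Delta> g\<^sub>k\<close> gives the numbers \<open>a\<^sub>\<alpha>\<^sub>,\<^sub>j\<close>.  Groups belonging to exponents
  outside \<open>\<Delta> f\<close>, whose coefficients cancel in \<open>f\<close>, and groups with empty \<open>\<Delta> g\<^sub>k\<close> only
  contribute nonnegative amounts at the nodes, which is why conditions (2) and (3) are inequalities.
\<close>

lemma gp2_feasible_imp_gp1_feasible:
  fixes f :: "'n::finite rpoly"
  assumes st: "st_standard_form f A" and feas: "gp2_feasible f r"
  shows "\<exists>a. gp1_feasible f A r a"
proof -
  note A = even_simplex_st[OF st]
  have A0: "A 0 = 0" using A by (simp add: even_simplex_def)
  obtain s g where g: "\<And>k. k \<in> {1..s::nat} \<Longrightarrow> circuit_poly (g k)"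
      "\<And>k. k \<in> {1..s} \<Longrightarrow> nonneg_poly (g k)"
      "\<And>k. k \<in> {1..s} \<Longrightarrow> newton (g k) face_of (convex hull ({0} \<union> newton_vertices f))"
    and sum: "f - const_poly r = (\<Sum>k=1..s. g k)"
    using feas unfolding gp2_feasible_def by blast
  have gst: "st_standard_form (g k) A" if "k \<in> {1..s}" for k
    using g(1,3)[OF that] st_standard_form_transfer[OF st] by (auto simp: circuit_poly_def)
  define K where "K \<alpha> = {k\<in>{1..s}. \<Delta> (g k) = {\<alpha>}}" for \<alpha>
  define a where "a \<alpha> j = (\<Sum>k\<in>K \<alpha>. coeff_at (g k) (A j))" for \<alpha> j
  have Ks: "K \<alpha> \<subseteq> {1..s}" and finK: "finite (K \<alpha>)" for \<alpha> by (auto simp: K_def)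
  have gnn: "coeff_at (g k) (A j) \<ge> 0" if "k \<in> {1..s}" "j \<le> CARD('n)" for k j
    using gst[OF that(1)] that(2) by (auto simp: st_standard_form_def)
  have ann: "a \<alpha> j \<ge> 0" if "j \<le> CARD('n)" for \<alpha> j
    unfolding a_def using Ks gnn that by (intro sum_nonneg) blast
  have coeff: "coeff_at f \<alpha> = (\<Sum>k\<in>K \<alpha>. coeff_at (g k) \<alpha>)" if al: "\<alpha> \<in> \<Delta> f" for \<alpha>
  proof -
    have node: "\<alpha> \<notin> A ` {..CARD('n)}" using nonsquare_not_node[OF st] al by auto
    hence "\<alpha> \<noteq> 0" using A0 by force
    hence "coeff_at f \<alpha> = coeff_at (f - const_poly r) \<alpha>" by (simp add: lookup_minus coeff_const_poly)
    also have "\<dots> = (\<Sum>k=1..s. coeff_at (g k) \<alpha>)" by (simp add: sum lookup_sum)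
    also have "\<dots> = (\<Sum>k\<in>K \<alpha>. coeff_at (g k) \<alpha>)"
    proof (rule sum.mono_neutral_right)
      show "\<forall>k\<in>{1..s} - K \<alpha>. coeff_at (g k) \<alpha> = 0"
      proof (rule ballI, rule ccontr)
        fix k assume k: "k \<in> {1..s} - K \<alpha>" and "coeff_at (g k) \<alpha> \<noteq> 0"
        \<comment> \<open>Outside the nodes, the support of \<open>g k\<close> is \<open>\<Delta> (g k)\<close>; the transferred standard form rules out monomial squares at \<open>\<alpha>\<close>.\<close>
        hence "\<alpha> \<in> \<Delta> (g k)" using gst[of k] node by (auto simp: st_standard_form_def in_keys_iff)
        hence "\<Delta> (g k) = {\<alpha>}" using g(1)[of k] k by (auto simp: circuit_poly_def)
        thus False using k by (auto simp: K_def)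
      qed
    qed (use Ks in auto)
    finally show ?thesis .
  qed
  have Kne: "K \<alpha> \<noteq> {}" if "\<alpha> \<in> \<Delta> f" for \<alpha>
    using coeff[OF that] nonsquare_ne_0[OF that] by auto
  have apos: "a \<alpha> j > 0" if al: "\<alpha> \<in> \<Delta> f" and j: "j \<in> nz A \<alpha>" for \<alpha> j
    unfolding a_def
  proof (rule sum_pos[OF finK Kne[OF al]])
    fix k assume "k \<in> K \<alpha>"
    hence "k \<in> {1..s}" "\<alpha> \<in> \<Delta> (g k)" by (auto simp: K_def)
    thus "coeff_at (g k) (A j) > 0"
      using st_bary_pos(1)[OF gst _ j] by (auto simp: pos_nodes_def)
  qed
  have circ: "\<bar>coeff_at f \<alpha>\<bar> \<le> (\<Prod>j\<in>nz A \<alpha>. (a \<alpha> j / bary A \<alpha> j) powr bary A \<alpha> j)"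
    if al: "\<alpha> \<in> \<Delta> f" for \<alpha>
  proof (rule bound_imp_circuit_number[OF finite_nz _ sum_bary_nz[OF st_bary[OF st al]]])
    \<comment> \<open>The values outside \<open>nz \<alpha>\<close> are kept at 1, so these nodes only contribute the constant \<open>?C\<close>.\<close>
    let ?C = "\<Sum>j\<in>{..CARD('n)} - nz A \<alpha>. a \<alpha> j"
    fix v :: "nat \<Rightarrow> real" assume v: "\<And>j. j \<in> nz A \<alpha> \<Longrightarrow> v j > 0"
    define u where "u j = (if j \<in> nz A \<alpha> then v j else 1)" for j
    have u: "u j > 0" for j using v by (auto simp: u_def)
    let ?Q = "\<Prod>j\<in>nz A \<alpha>. u j powr bary A \<alpha> j"
    have "\<bar>coeff_at f \<alpha>\<bar> * ?Q \<le> (\<Sum>k\<in>K \<alpha>. \<bar>coeff_at (g k) \<alpha>\<bar>) * ?Q"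
      unfolding coeff[OF al] by (intro mult_right_mono sum_abs prod_nonneg) auto
    also have "\<dots> = (\<Sum>k\<in>K \<alpha>. \<bar>coeff_at (g k) \<alpha>\<bar> * ?Q)" by (rule sum_distrib_right)
    also have "\<dots> \<le> (\<Sum>k\<in>K \<alpha>. \<Sum>j\<le>CARD('n). coeff_at (g k) (A j) * u j)"
      using gst g(2) u by (intro sum_mono nonneg_st_imp_bound) (auto simp: K_def)
    also have "\<dots> = (\<Sum>j\<le>CARD('n). a \<alpha> j * u j)"
      unfolding a_def by (subst sum.swap) (simp add: sum_distrib_right)
    also have "{..CARD('n)} = nz A \<alpha> \<union> ({..CARD('n)} - nz A \<alpha>)" by (auto simp: nz_def)
    also have "(\<Sum>j\<in>\<dots>. a \<alpha> j * u j) = (\<Sum>j\<in>nz A \<alpha>. a \<alpha> j * u j) + (\<Sum>j\<in>{..CARD('n)} - nz A \<alpha>. a \<alpha> j * u j)"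
      by (intro sum.union_disjoint) (auto simp: finite_nz)
    finally show "\<bar>coeff_at f \<alpha>\<bar> * (\<Prod>j\<in>nz A \<alpha>. v j powr bary A \<alpha> j) \<le> (\<Sum>j\<in>nz A \<alpha>. a \<alpha> j * v j) + ?C"
      by (simp add: u_def)
  qed (use st_bary_pos(2)[OF st al] apos[OF al] in auto)
  have total: "(\<Sum>\<alpha>\<in>\<Delta> f. a \<alpha> j) \<le> coeff_at (f - const_poly r) (A j)" if j: "j \<le> CARD('n)" for j
  proof -
    have "(\<Sum>\<alpha>\<in>\<Delta> f. a \<alpha> j) = (\<Sum>k\<in>(\<Union>\<alpha>\<in>\<Delta> f. K \<alpha>). coeff_at (g k) (A j))"
      unfolding a_def by (rule sum.UNION_disjoint[symmetric]) (auto simp: finite_nonsquare K_def)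
    also have "\<dots> \<le> (\<Sum>k=1..s. coeff_at (g k) (A j))"
      using Ks gnn[OF _ j] by (intro sum_mono2) auto
    also have "\<dots> = coeff_at (f - const_poly r) (A j)" by (simp add: sum lookup_sum)
    finally show ?thesis .
  qed
  have An0: "A j \<noteq> 0" if "1 \<le> j" "j \<le> CARD('n)" for j
    using even_simplex_injD[OF A, of j 0] that A0 by auto
  define C where "C \<alpha> = bary A \<alpha> 0 * \<bar>coeff_at f \<alpha>\<bar> powr (1 / bary A \<alpha> 0) *
          (\<Prod>j\<in>{j\<in>nz A \<alpha>. j \<ge> 1}. (bary A \<alpha> j / a \<alpha> j) powr (bary A \<alpha> j / bary A \<alpha> 0))" for \<alpha>
  have Cle: "C \<alpha> \<le> a \<alpha> 0" if al: "\<alpha> \<in> \<Delta> f" and 0: "0 \<in> nz A \<alpha>" for \<alpha>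
  proof -
    let ?N = "{j\<in>nz A \<alpha>. j \<ge> 1}"
    have "\<bar>coeff_at f \<alpha>\<bar> \<le> (a \<alpha> 0 / bary A \<alpha> 0) powr bary A \<alpha> 0 *
            (\<Prod>j\<in>?N. (a \<alpha> j / bary A \<alpha> j) powr bary A \<alpha> j)"
      using circ[OF al] unfolding prod_nz_split_0[OF 0] .
    thus ?thesis unfolding C_def
      using st_bary_pos(2)[OF st al] apos[OF al] 0 nonsquare_ne_0[OF al] ann[of 0 \<alpha>]
      by (subst (asm) circuit_number_le_iff_constant_ge) (auto simp: finite_nz)
  qed
  have "(\<Sum>\<alpha>\<in>{\<alpha>\<in>\<Delta> f. 0 \<in> nz A \<alpha>}. C \<alpha>) \<le> (\<Sum>\<alpha>\<in>{\<alpha>\<in>\<Delta> f. 0 \<in> nz A \<alpha>}. a \<alpha> 0)"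
    using Cle by (intro sum_mono) auto
  also have "\<dots> \<le> (\<Sum>\<alpha>\<in>\<Delta> f. a \<alpha> 0)"
    using ann by (intro sum_mono2) (auto simp: finite_nonsquare)
  also have "\<dots> \<le> coeff_at f 0 - r"
    using total[of 0] by (simp add: A0 lookup_minus coeff_const_poly)
  finally have const: "(\<Sum>\<alpha>\<in>{\<alpha>\<in>\<Delta> f. 0 \<in> nz A \<alpha>}. C \<alpha>) \<le> coeff_at f 0 - r" .
  have "gp1_feasible f A r a"
    unfolding gp1_feasible_def
  proof (intro conjI ballI impI)
    fix \<alpha> assume al: "\<alpha> \<in> \<Delta> f" and z: "bary A \<alpha> 0 = 0"
    have "{j\<in>nz A \<alpha>. j \<ge> 1} = nz A \<alpha>" using z by (intro nz_without_0) (simp add: nz_def)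
    thus "\<bar>coeff_at f \<alpha>\<bar> \<le> (\<Prod>j\<in>{j\<in>nz A \<alpha>. j \<ge> 1}. (a \<alpha> j / bary A \<alpha> j) powr bary A \<alpha> j)"
      using circ[OF al] by simp
  next
    fix j assume j: "j \<in> {1..CARD('n)}"
    thus "(\<Sum>\<alpha>\<in>\<Delta> f. a \<alpha> j) \<le> coeff_at f (A j)"
      using total[of j] An0[of j] by (simp add: lookup_minus coeff_const_poly)
  qed (use ann apos const in \<open>auto simp: C_def nz_def\<close>)
  thus ?thesis by blast
qed

theorem theorem3p5:
  fixes f :: "'n::finite rpoly" and A :: "nat \<Rightarrow> nat ^ 'n"
  assumes "st_standard_form f A"
  shows "gp1 f A = gp2 f"
proof -
  have "{r. \<exists>a. gp1_feasible f A r a} = {r. gp2_feasible f r}"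
    using gp1_feasible_imp_gp2_feasible[OF assms] gp2_feasible_imp_gp1_feasible[OF assms] by blast
  thus ?thesis by (simp add: gp1_def gp2_def)
qed

end
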